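(* Let $n\ge 1$, let $f:\{0,1\}^n\to\{0,1\}$ be any function, let $0\le k\le n$ be an integer and let $0<p<1$. Then $$\max_{\mathbb{Q}\in\mathcal{A}(n,k,p)}\mathbb{Q}(f=1)=\min_{P\in P_k^+(f)}\mathbb{E}_{\mathbb{P}_p}P(X_1,\ldots,X_n),\qquad \min_{\mathbb{Q}\in\mathcal{A}(n,k,p)}\mathbb{Q}(f=1)=\max_{P\in P_k^-(f)}\mathbb{E}_{\mathbb{P}_p}P(X_1,\ldots,X_n).$$
   Context: $\mathcal{A}(n,k,p)$ is the set of all probability distributions $\mathbb{Q}$ of $n$ bits $(X_1,\ldots,X_n)\in\{0,1\}^n$ that are $k$-wise independent (every subset of at most $k$ of the bits is independent) and satisfy $\mathbb{Q}(X_i=1)=p$ for all $i$. $\mathbb{P}_p$ is the distribution of $n$ fully independent bits, each equal to $1$ with probability $p$. $P_k^+(f)$ is the set of real polynomials $P:\mathbb{R}^n\to\mathbb{R}$ of degree at most $k$ with $P(x)\ge f(x)$ for all $x\in\{0,1\}^n$; $P_k^-(f)$ is the set of real polynomials of degree at most $k$ with $P(x)\le f(x)$ for all $x\in\{0,1\}^n$.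
   Formalization: For k=0 the condition Q(X_i=1)=p is dropped, so A(n,0,p) is all distributions; with it the claim fails (n=1, f(x)=x_1: the maximum is p<1 but the least constant above f is 1). For k≥1 nothing is changed. *)

theory Defs
  imports "HOL-Probability.Probability" "HOL-Probability.Product_PMF" "HOL-Library.Poly_Mapping"
begin

text \<open>
  The bits are indexed by a finite type \<open>'n\<close>, so \<open>n = CARD('n) \<ge> 1\<close>. A point of
  \<open>{0,1}\<^sup>n\<close> is a function \<open>'n \<Rightarrow> bool\<close>, with \<open>True\<close> for the value 1. The cube is finite, so
  the probability distributions on it are exactly the elements of \<open>('n \<Rightarrow> bool) pmf\<close>.
\<close>

definition iid_bits :: "real \<Rightarrow> ('n::finite \<Rightarrow> bool) pmf" where
  "iid_bits p = Pi_pmf UNIV False (\<lambda>_. bernoulli_pmf p)"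

text \<open>
  The condition \<open>Q(X\<^sub>i = 1) = p\<close> is imposed on the bits of each subset of size at most \<open>k\<close>.
  For \<open>k \<ge> 1\<close> this is the condition for all \<open>i\<close>, see \<open>kwise_indep_dists_altdef\<close> below.
  For \<open>k = 0\<close> it is void. Keeping the marginals fixed at \<open>k = 0\<close> would make the
  duality false: for \<open>n = 1\<close> and \<open>f(x) = x\<^sub>1\<close>, the maximum of \<open>Q(f = 1)\<close> would be \<open>p\<close>, whereas
  the least constant above \<open>f\<close> is 1.
\<close>

definition kwise_indep_dists :: "nat \<Rightarrow> real \<Rightarrow> ('n::finite \<Rightarrow> bool) pmf set" where
  "kwise_indep_dists k p =
     {Q. \<forall>S. card S \<le> k \<longrightarrow>
           prob_space.indep_vars (measure_pmf Q) (\<lambda>_. count_space UNIV) (\<lambda>i x. x i) S \<and>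
           (\<forall>i\<in>S. measure_pmf.prob Q {x. x i} = p)}"

lemma kwise_indep_dists_altdef:
  assumes "k \<ge> 1"
  shows "kwise_indep_dists k p =
     {Q :: ('n::finite \<Rightarrow> bool) pmf.
        (\<forall>S. card S \<le> k \<longrightarrow>
           prob_space.indep_vars (measure_pmf Q) (\<lambda>_. count_space UNIV) (\<lambda>i x. x i) S) \<and>
        (\<forall>i. measure_pmf.prob Q {x. x i} = p)}"
proof -
  have "measure_pmf.prob Q {x. x i} = p"
    if "Q \<in> kwise_indep_dists k p" for Q :: "('n \<Rightarrow> bool) pmf" and i
  proof -
    have "card {i} \<le> k" using assms by simp
    then show ?thesis using that unfolding kwise_indep_dists_def by blast
  qed
  then show ?thesis unfolding kwise_indep_dists_def by blast
qed

text \<open>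
  Real polynomials in the variables \<open>'n\<close>: finitely supported maps from exponent vectors to
  coefficients.
\<close>

type_synonym 'n rpoly = "('n \<Rightarrow>\<^sub>0 nat) \<Rightarrow>\<^sub>0 real"

definition rpoly_eval :: "'n::finite rpoly \<Rightarrow> ('n \<Rightarrow> real) \<Rightarrow> real" where
  "rpoly_eval P x =
     (\<Sum>m\<in>Poly_Mapping.keys P.
        Poly_Mapping.lookup P m * (\<Prod>i\<in>UNIV. x i ^ Poly_Mapping.lookup m i))"

text \<open>Total degree, with the zero polynomial given degree 0.\<close>

definition rpoly_degree :: "'n::finite rpoly \<Rightarrow> nat" where
  "rpoly_degree P =
     Max (insert 0 ((\<lambda>m. \<Sum>i\<in>UNIV. Poly_Mapping.lookup m i) ` Poly_Mapping.keys P))"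

definition bits_to_reals :: "('n \<Rightarrow> bool) \<Rightarrow> 'n \<Rightarrow> real" where
  "bits_to_reals x = (\<lambda>i. of_bool (x i))"

definition upper_polys :: "nat \<Rightarrow> (('n::finite \<Rightarrow> bool) \<Rightarrow> bool) \<Rightarrow> 'n rpoly set" where
  "upper_polys k f =
     {P. rpoly_degree P \<le> k \<and> (\<forall>x. rpoly_eval P (bits_to_reals x) \<ge> of_bool (f x))}"

definition lower_polys :: "nat \<Rightarrow> (('n::finite \<Rightarrow> bool) \<Rightarrow> bool) \<Rightarrow> 'n rpoly set" where
  "lower_polys k f =
     {P. rpoly_degree P \<le> k \<and> (\<forall>x. rpoly_eval P (bits_to_reals x) \<le> of_bool (f x))}"

definition iid_expectation :: "real \<Rightarrow> 'n::finite rpoly \<Rightarrow> real" where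
  "iid_expectation p P =
     measure_pmf.expectation (iid_bits p) (\<lambda>x. rpoly_eval P (bits_to_reals x))"

end

theory Submission
  imports Defs
begin

text \<open>
  On the cube, polynomials of degree at most \<open>k\<close> are exactly the span \<open>V\<close> of the multilinear
  monomials \<open>\<Prod>i\<in>S. x\<^sub>i\<close> with \<open>card S \<le> k\<close>, and \<open>Q\<close> is \<open>k\<close>-wise independent with marginals \<open>p\<close>
  iff \<open>Q\<close> and \<open>iid_bits p\<close> have the same expectation on \<open>V\<close>. Weak duality is immediate.
  Since \<open>0 < p < 1\<close>, \<open>iid_bits p\<close> charges every point, so the minimum \<open>v\<close> over \<open>g \<in> V\<close>, \<open>g \<ge> F\<close>
  is attained by compactness. A hyperplane separating \<open>{g - F | g \<in> V, E g < v}\<close> from the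
  nonnegative orthant has nonnegative coefficients, which normalise to an optimal \<open>Q\<close>.
  The statement on lower polynomials is the case \<open>F = -f\<close>.
\<close>

section \<open>Linear programming duality on a finite set\<close>

lemma expectation_finite_type:
  fixes Q :: "'a::finite pmf" and h :: "'a \<Rightarrow> real"
  shows "measure_pmf.expectation Q h = (\<Sum>x\<in>UNIV. h x * pmf Q x)"
  by (rule integral_measure_pmf_real) auto

lemma pmf_of_weights:
  fixes q :: "'a::finite \<Rightarrow> real"
  assumes "\<And>x. q x \<ge> 0" and "(\<Sum>x\<in>UNIV. q x) = 1"
  obtains Q where "\<And>x. pmf Q x = q x"
proof
  fix x
  show "pmf (embed_pmf q) x = q x"
    by (rule pmf_embed_pmf) (use assms in \<open>auto simp: nn_integral_count_space_finite\<close>)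
qed

text \<open>Positive weights make the problem coercive: an upper bound on
  \<open>w \<bullet> g\<close> bounds every coordinate of a \<open>g\<close> above \<open>F\<close>,
  so the competitive feasible points form a compact set.\<close>

lemma finite_lp_min_attained:
  fixes w :: "real^'a" and V :: "(real^'a) set" and F :: "real^'a"
  assumes w: "\<And>x. w $ x > 0" and V: "subspace V" "vec 1 \<in> V"
  obtains g where "g \<in> V" and "\<And>x. F $ x \<le> g $ x"
    and "\<And>h. h \<in> V \<Longrightarrow> (\<And>x. F $ x \<le> h $ x) \<Longrightarrow> w \<bullet> g \<le> w \<bullet> h"
proof -
  define M where "M = (\<Sum>x\<in>UNIV. \<bar>F $ x\<bar>)"
  have FM: "\<bar>F $ x\<bar> \<le> M" for x unfolding M_def by (rule member_le_sum) auto
  define g0 :: "real^'a" where "g0 = vec M"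
  have g0: "g0 \<in> V" "\<And>x. F $ x \<le> g0 $ x"
    using subspace_scale[OF V, of M] FM unfolding g0_def
    by (auto simp: vec_eq_iff vec_def scaleR_vec_def abs_le_iff)
  define K where "K = V \<inter> {g. \<forall>x. F $ x \<le> g $ x} \<inter> {g. w \<bullet> g \<le> w \<bullet> g0}"
  have "closed K" unfolding K_def
    by (intro closed_Int closed_subspace V closed_Collect_all closed_Collect_le continuous_intros)
  moreover have "bounded K"
  proof -
    \<comment> \<open>All weighted gaps \<open>w $ y * (g $ y - F $ y)\<close> are nonnegative, so
      each is at most their sum. This gives the upper bound \<open>B x\<close> on
      \<open>g $ x\<close>; the lower bound \<open>- M\<close> comes from \<open>F\<close>.\<close>
    define B where "B x = (w \<bullet> g0 - w \<bullet> F) / w $ x + M" for x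
    have "\<bar>g $ x\<bar> \<le> max M (B x)" if "g \<in> K" for g x
    proof -
      have g: "F $ y \<le> g $ y" for y using that by (auto simp: K_def)
      have "w $ x * (g $ x - F $ x) \<le> (\<Sum>y\<in>UNIV. w $ y * (g $ y - F $ y))"
        by (rule member_le_sum) (use g w in \<open>auto simp: less_imp_le\<close>)
      also have "\<dots> = w \<bullet> g - w \<bullet> F"
        by (simp add: inner_vec_def right_diff_distrib sum_subtractf)
      also have "\<dots> \<le> w \<bullet> g0 - w \<bullet> F" using that by (auto simp: K_def)
      finally have "g $ x - F $ x \<le> (w \<bullet> g0 - w \<bullet> F) / w $ x"
        using w[of x] by (simp add: field_simps)
      then show ?thesis using FM[of x] g[of x] by (auto simp: B_def)
    qed
    then have "norm g \<le> (\<Sum>x\<in>UNIV. max M (B x))" if "g \<in> K" for g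
      using that by (intro order.trans[OF norm_le_l1_cart] sum_mono) auto
    then show ?thesis unfolding bounded_iff by blast
  qed
  ultimately have "compact K" by (simp add: compact_eq_bounded_closed)
  moreover have "g0 \<in> K" using g0 by (auto simp: K_def)
  ultimately obtain g where g: "g \<in> K" "\<And>h. h \<in> K \<Longrightarrow> w \<bullet> g \<le> w \<bullet> h"
    using continuous_attains_inf[of K "\<lambda>h. w \<bullet> h"] continuous_on_inner[OF continuous_on_const continuous_on_id]
    by (metis empty_iff id_apply)
  have "w \<bullet> g \<le> w \<bullet> h" if "h \<in> V" "\<And>x. F $ x \<le> h $ x" for h
  proof (cases "w \<bullet> h \<le> w \<bullet> g0")
    case True
    then show ?thesis using that g(2) by (auto simp: K_def)
  next
    case False
    then show ?thesis using g(2)[OF \<open>g0 \<in> K\<close>] by simp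
  qed
  with g(1) show ?thesis by (intro that[of g]) (auto simp: K_def)
qed

lemma inner_vec_1: "a \<bullet> vec c = c * (\<Sum>x\<in>UNIV. a $ x)" for a :: "real^'a"
  by (simp add: inner_vec_def sum_distrib_left mult.commute)

text \<open>Agreement on \<open>V\<close> together with equal values certifies both optima: an
  \<open>h\<close> in \<open>V\<close> above \<open>F\<close> has the same expectation under
  \<open>w\<close> and \<open>Q\<close>, hence at least that of \<open>F\<close> under
  \<open>Q\<close>; and a distribution agreeing with \<open>w\<close> on \<open>V\<close> gives
  \<open>F\<close> at most the expectation of \<open>g\<close>.\<close>

lemma finite_lp_duality:
  fixes w :: "'a::finite pmf" and V :: "(real^'a) set" and F :: "real^'a"
  assumes w: "set_pmf w = UNIV" and V: "subspace V" "vec 1 \<in> V"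
  obtains Q g where "g \<in> V" and "\<And>x. F $ x \<le> g $ x"
    and "\<And>h. h \<in> V \<Longrightarrow> measure_pmf.expectation Q (($) h) = measure_pmf.expectation w (($) h)"
    and "measure_pmf.expectation Q (($) F) = measure_pmf.expectation w (($) g)"
proof -
  define W :: "real^'a" where "W = (\<chi> x. pmf w x)"
  have W1: "W \<bullet> vec c = c" for c
    using sum_pmf_eq_1[of UNIV w] by (simp add: inner_vec_1 W_def)
  have Wpos: "W $ x > 0" for x
    using w by (auto simp: W_def pmf_positive)
  obtain g where g: "g \<in> V" "\<And>x. F $ x \<le> g $ x"
    and gmin: "\<And>h. h \<in> V \<Longrightarrow> (\<And>x. F $ x \<le> h $ x) \<Longrightarrow> W \<bullet> g \<le> W \<bullet> h"
    using finite_lp_min_attained[OF Wpos V] by blast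
  define v where "v = W \<bullet> g"
  have vecV: "vec c \<in> V" for c
    using subspace_scale[OF V, of c] by (simp add: vec_def scaleR_vec_def)
  \<comment> \<open>The strict bound makes \<open>A\<close> miss the orthant \<open>B\<close>: a
    common point would come from a feasible \<open>h\<close> with value below the minimum
    \<open>v\<close>. The constant \<open>v - 1\<close> shows that \<open>A\<close> is
    nonempty.\<close>
  define A where "A = (\<lambda>h. h - F) ` (V \<inter> {h. W \<bullet> h < v})"
  define B :: "(real^'a) set" where "B = {h. \<forall>x. 0 \<le> h $ x}"
  have "convex A" unfolding A_def
    by (intro convex_translation_subtract convex_Int subspace_imp_convex[OF V(1)] convex_halfspace_lt)
  moreover have "convex B" unfolding B_def convex_def by auto
  moreover have "vec (v - 1) - F \<in> A" unfolding A_def using vecV W1 by auto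
  moreover have "0 \<in> B" by (simp add: B_def)
  moreover have "A \<inter> B = {}" using gmin by (fastforce simp: A_def B_def v_def)
  ultimately obtain a b where ab: "a \<noteq> 0" "\<And>x. x \<in> A \<Longrightarrow> a \<bullet> x \<le> b" "\<And>x. x \<in> B \<Longrightarrow> b \<le> a \<bullet> x"
    using separating_hyperplane_sets[of A B] by blast
  have "b \<le> 0" using ab(3)[OF \<open>0 \<in> B\<close>] by simp
  have a0: "a $ x \<ge> 0" for x
  proof (rule ccontr)
    assume neg: "\<not> a $ x \<ge> 0"
    \<comment> \<open>The entry is chosen so that the inner product with \<open>a\<close> is
      \<open>b - 1\<close>, below the bound \<open>b\<close> valid on \<open>B\<close>.\<close>
    have "(b - 1) / a $ x \<ge> 0" using neg \<open>b \<le> 0\<close> by (simp add: divide_nonpos_neg)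
    then have "axis x ((b - 1) / a $ x) \<in> B" by (auto simp: B_def axis_def)
    from ab(3)[OF this] neg show False by (simp add: inner_axis)
  qed
  have aV: "a \<bullet> h \<le> a \<bullet> F" if "h \<in> V" "W \<bullet> h < v" for h
    using ab(2)[of "h - F"] that \<open>b \<le> 0\<close> by (force simp: A_def inner_diff_right)
  define c where "c = (\<Sum>x\<in>UNIV. a $ x)"
  have "c > 0"
  proof -
    have "c \<noteq> 0" using \<open>a \<noteq> 0\<close> a0 by (auto simp: c_def sum_nonneg_eq_0_iff vec_eq_iff)
    then show ?thesis using a0 by (simp add: c_def sum_nonneg less_le)
  qed
  have a_null: "a \<bullet> h \<le> 0" if h: "h \<in> V" "W \<bullet> h = 0" for h
  proof (rule ccontr)
    assume pos: "\<not> a \<bullet> h \<le> 0"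
    \<comment> \<open>Moving from the constant \<open>v - 1\<close> along \<open>h\<close> keeps the
      value at \<open>v - 1\<close>, so \<open>aV\<close> applies for every \<open>t\<close>; this
      \<open>t\<close> makes the left side exceed \<open>a \<bullet> F\<close> by 1.\<close>
    define t where "t = (a \<bullet> F - (v - 1) * c + 1) / (a \<bullet> h)"
    have "vec (v - 1) + t *\<^sub>R h \<in> V" using V vecV h by (intro subspace_add subspace_scale)
    from aV[OF this] have "(v - 1) * c + t * (a \<bullet> h) \<le> a \<bullet> F"
      using h by (simp add: inner_add_right W1) (simp add: inner_vec_1 c_def)
    then show False using pos by (simp add: t_def)
  qed
  have a_eq: "a \<bullet> h = c * (W \<bullet> h)" if h: "h \<in> V" for h
  proof -
    \<comment> \<open>Centring \<open>h\<close> gives a vector of \<open>W\<close>-value 0;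
      \<open>a_null\<close> for it and for its negative turns the inequality into an
      equality.\<close>
    define h' where "h' = h - vec (W \<bullet> h)"
    have h': "h' \<in> V" "W \<bullet> h' = 0"
      using V vecV h by (auto simp: h'_def subspace_diff inner_diff_right W1)
    have "a \<bullet> h' = 0"
      using a_null[OF h'] a_null[of "- h'"] h' V by (simp add: subspace_neg)
    then show ?thesis by (simp add: h'_def inner_diff_right inner_vec_1 c_def)
  qed
  obtain Q where Q: "\<And>x. pmf Q x = a $ x / c"
    by (rule pmf_of_weights[of "\<lambda>x. a $ x / c"])
      (use a0 \<open>c > 0\<close> in \<open>auto simp: c_def simp flip: sum_divide_distrib\<close>)
  have EQ: "measure_pmf.expectation Q (($) h) = (a \<bullet> h) / c" for h
    by (simp add: expectation_finite_type Q inner_vec_def sum_divide_distrib mult.commute)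
  have Ew: "measure_pmf.expectation w (($) h) = W \<bullet> h" for h
    by (simp add: expectation_finite_type W_def inner_vec_def mult.commute)
  have EV: "measure_pmf.expectation Q (($) h) = measure_pmf.expectation w (($) h)" if "h \<in> V" for h
    using a_eq[OF that] \<open>c > 0\<close> by (simp add: EQ Ew)
  \<comment> \<open>Constants \<open>u < v\<close> are admissible in \<open>aV\<close>, and letting
    \<open>u\<close> rise to \<open>v\<close> gives this bound. The reverse bound uses nonnegativity
    of \<open>a\<close> and that \<open>g\<close> lies above \<open>F\<close>.\<close>
  have "v \<le> (a \<bullet> F) / c"
  proof (rule dense_le)
    fix u assume "u < v"
    then have "u * c \<le> a \<bullet> F"
      using aV[OF vecV, of u] by (simp add: W1) (simp add: inner_vec_1 c_def)
    then show "u \<le> (a \<bullet> F) / c" using \<open>c > 0\<close> by (simp add: field_simps)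
  qed
  moreover have "a \<bullet> F \<le> a \<bullet> g"
    unfolding inner_vec_def by (auto intro!: sum_mono mult_left_mono g a0)
  then have "(a \<bullet> F) / c \<le> v" using a_eq[OF g(1)] \<open>c > 0\<close> by (simp add: v_def field_simps)
  ultimately have "measure_pmf.expectation Q (($) F) = measure_pmf.expectation w (($) g)"
    by (simp add: EQ Ew v_def)
  with g EV show ?thesis by (intro that[of g Q])
qed

section \<open>Low-degree polynomials as functions on the cube\<close>

definition bit_monom :: "'n::finite set \<Rightarrow> real^('n \<Rightarrow> bool)" where
  "bit_monom S = (\<chi> x. \<Prod>i\<in>S. of_bool (x i))"

text \<open>Functions on the cube are encoded as vectors so that this span can serve as the subspace
  \<open>V\<close> in the duality above.\<close>

definition low_degree :: "nat \<Rightarrow> (real^('n::finite \<Rightarrow> bool)) set" where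
  "low_degree k = span (bit_monom ` {S. card S \<le> k})"

abbreviation total_degree :: "('n::finite \<Rightarrow>\<^sub>0 nat) \<Rightarrow> nat" where
  "total_degree m \<equiv> \<Sum>i\<in>UNIV. Poly_Mapping.lookup m i"

lemma rpoly_degree_le_iff:
  "rpoly_degree P \<le> k \<longleftrightarrow> (\<forall>m\<in>Poly_Mapping.keys P. total_degree m \<le> k)"
  unfolding rpoly_degree_def by (subst Max_le_iff) auto

text \<open>Addition can cancel keys; summing over a common superset of the keys makes additivity of
  evaluation visible.\<close>

lemma rpoly_eval_superset:
  assumes "finite A" "Poly_Mapping.keys P \<subseteq> A"
  shows "rpoly_eval P x =
    (\<Sum>m\<in>A. Poly_Mapping.lookup P m * (\<Prod>i\<in>UNIV. x i ^ Poly_Mapping.lookup m i))"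
  unfolding rpoly_eval_def using assms by (intro sum.mono_neutral_left) (auto simp: in_keys_iff)

lemma rpoly_eval_add: "rpoly_eval (P + Q) x = rpoly_eval P x + rpoly_eval Q x"
proof -
  let ?A = "Poly_Mapping.keys P \<union> Poly_Mapping.keys Q"
  show ?thesis
    using rpoly_eval_superset[of ?A P] rpoly_eval_superset[of ?A Q]
      rpoly_eval_superset[of ?A "P + Q"] keys_add[of P Q]
    by (simp add: lookup_add distrib_right sum.distrib)
qed

lemma rpoly_eval_single:
  "rpoly_eval (Poly_Mapping.single m c) x = c * (\<Prod>i\<in>UNIV. x i ^ Poly_Mapping.lookup m i)"
  by (subst rpoly_eval_superset[of "{m}"]) auto

text \<open>On bits \<open>x\<^sub>i\<^sup>e = x\<^sub>i\<close> for \<open>e > 0\<close>.\<close>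

lemma monomial_eq_bit_monom:
  "(\<Prod>i\<in>UNIV. bits_to_reals x i ^ Poly_Mapping.lookup m i) = bit_monom (Poly_Mapping.keys m) $ x"
proof -
  have "(\<Prod>i\<in>UNIV. bits_to_reals x i ^ Poly_Mapping.lookup m i) =
        (\<Prod>i\<in>Poly_Mapping.keys m. bits_to_reals x i ^ Poly_Mapping.lookup m i)"
    by (rule prod.mono_neutral_right) (auto simp: in_keys_iff)
  also have "\<dots> = (\<Prod>i\<in>Poly_Mapping.keys m. of_bool (x i))"
    by (rule prod.cong) (auto simp: bits_to_reals_def in_keys_iff)
  finally show ?thesis by (simp add: bit_monom_def)
qed

text \<open>Each variable that occurs has exponent at least 1, so passing to the multilinear
  monomial does not raise the degree.\<close>

lemma card_keys_le_total_degree: "card (Poly_Mapping.keys m) \<le> total_degree m"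
proof -
  have "card (Poly_Mapping.keys m) \<le> (\<Sum>i\<in>Poly_Mapping.keys m. Poly_Mapping.lookup m i)"
    unfolding card_eq_sum by (intro sum_mono) (auto simp: in_keys_iff Suc_le_eq)
  also have "\<dots> \<le> total_degree m" by (rule sum_mono2) auto
  finally show ?thesis .
qed

lemma rpoly_in_low_degree:
  assumes "rpoly_degree P \<le> k"
  shows "(\<chi> x. rpoly_eval P (bits_to_reals x)) \<in> low_degree k"
proof -
  have "(\<chi> x. rpoly_eval P (bits_to_reals x)) =
    (\<Sum>m\<in>Poly_Mapping.keys P. Poly_Mapping.lookup P m *\<^sub>R bit_monom (Poly_Mapping.keys m))"
    by (simp add: vec_eq_iff rpoly_eval_def monomial_eq_bit_monom)
  also have "\<dots> \<in> low_degree k"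
    unfolding low_degree_def
    by (intro span_sum span_scale span_base imageI CollectI)
      (use assms card_keys_le_total_degree order.trans in \<open>unfold rpoly_degree_le_iff, blast\<close>)
  finally show ?thesis .
qed

text \<open>Converse to \<open>rpoly_in_low_degree\<close>, by induction over linear combinations:
  one monomial is added at a time, and the degree of the sum is controlled through its keys.\<close>

lemma rpoly_of_low_degree:
  assumes "h \<in> low_degree k"
  obtains P where "rpoly_degree P \<le> k" "\<And>x. rpoly_eval P (bits_to_reals x) = h $ x"
proof -
  have "\<exists>P. rpoly_degree P \<le> k \<and> (\<forall>x. rpoly_eval P (bits_to_reals x) = h $ x)"
    using assms unfolding low_degree_def
  proof (induction rule: span_induct_alt)
    case base
    show ?case by (rule exI[of _ 0]) (simp add: rpoly_degree_def rpoly_eval_def)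
  next
    case (step c y z)
    then obtain S P where S: "card S \<le> k" "y = bit_monom S"
      and P: "rpoly_degree P \<le> k" "\<And>x. rpoly_eval P (bits_to_reals x) = z $ x"
      by blast
    \<comment> \<open>Exponent 1 on \<open>S\<close> and 0 elsewhere, so the total degree is exactly
      \<open>card S\<close>.\<close>
    define m where "m = Abs_poly_mapping (\<lambda>i. of_bool (i \<in> S) :: nat)"
    have m: "Poly_Mapping.lookup m i = of_bool (i \<in> S)" for i by (simp add: m_def)
    then have km: "Poly_Mapping.keys m = S" by (auto simp: in_keys_iff)
    have "total_degree m = card S" by (simp add: m)
    then have "rpoly_degree (Poly_Mapping.single m c + P) \<le> k"
      using P(1) S(1) keys_add[of "Poly_Mapping.single m c" P]
      by (auto simp: rpoly_degree_le_iff split: if_splits)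
    moreover have "rpoly_eval (Poly_Mapping.single m c + P) (bits_to_reals x) = (c *\<^sub>R y + z) $ x" for x
      by (simp add: rpoly_eval_add rpoly_eval_single monomial_eq_bit_monom km S P)
    ultimately show ?case by blast
  qed
  then show ?thesis using that by blast
qed

section \<open>Independence as agreement of low-degree expectations\<close>

text \<open>The indicator of any event about one bit is affine in that bit; expanding the product
  yields monomials indexed by the subsets of \<open>J\<close>.\<close>

lemma prod_bits_in_low_degree:
  fixes A :: "'n::finite \<Rightarrow> bool set"
  assumes "card J \<le> k"
  shows "(\<chi> x. \<Prod>j\<in>J. of_bool (x j \<in> A j)) \<in> low_degree k"
proof -
  define b where "b j = (of_bool (False \<in> A j) :: real)" for j
  define d where "d j = of_bool (True \<in> A j) - b j" for j
  have split: "of_bool (x j \<in> A j) = d j * of_bool (x j) + b j" for x j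
    by (cases "x j") (auto simp: d_def b_def)
  have "(\<chi> x. \<Prod>j\<in>J. of_bool (x j \<in> A j)) = (\<Sum>S\<in>Pow J. (prod d S * prod b (J - S)) *\<^sub>R bit_monom S)"
    by (simp add: vec_eq_iff split prod_add bit_monom_def prod.distrib mult_ac)
  also have "\<dots> \<in> low_degree k"
    unfolding low_degree_def
    by (intro span_sum span_scale span_base imageI CollectI)
      (metis assms PowD card_mono finite order.trans)
  finally show ?thesis .
qed

lemma expectation_prod_bits:
  fixes A :: "'n::finite \<Rightarrow> bool set"
  shows "measure_pmf.expectation Q (\<lambda>x. \<Prod>j\<in>J. of_bool (x j \<in> A j)) =
    measure_pmf.prob Q (\<Inter>j\<in>J. (\<lambda>x. x j) -` A j)"
proof -
  have "(\<lambda>x. \<Prod>j\<in>J. of_bool (x j \<in> A j)) = (indicator (\<Inter>j\<in>J. (\<lambda>x. x j) -` A j) :: _ \<Rightarrow> real)"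
    by (auto simp: fun_eq_iff indicator_def of_bool_def)
  then show ?thesis by simp
qed

lemma iid_bits_kwise:
  assumes "0 < p" "p < 1"
  shows "(iid_bits p :: ('n::finite \<Rightarrow> bool) pmf) \<in> kwise_indep_dists k p"
proof -
  let ?I = "iid_bits p :: ('n \<Rightarrow> bool) pmf"
  have "prob_space.indep_vars ?I (\<lambda>_. count_space UNIV) (\<lambda>i x. x i) S" for S :: "'n set"
    using indep_vars_Pi_pmf[of UNIV False "\<lambda>_. bernoulli_pmf p"]
    by (metis iid_bits_def subset_UNIV prob_space.indep_vars_subset[OF measure_pmf.prob_space_axioms] finite)
  moreover have "measure_pmf.prob ?I {x. x i} = p" for i :: 'n
  proof -
    have "measure_pmf.prob ?I {x. x i} = measure_pmf.prob (map_pmf (\<lambda>x. x i) (iid_bits p)) {True}"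
      by (simp add: vimage_def)
    also have "\<dots> = p" using assms by (simp add: iid_bits_def Pi_pmf_component measure_pmf_single)
    finally show ?thesis .
  qed
  ultimately show ?thesis by (auto simp: kwise_indep_dists_def)
qed

lemma expectation_bit_monom_kwise:
  fixes S :: "'n::finite set"
  assumes "Q \<in> kwise_indep_dists k p" "card S \<le> k"
  shows "measure_pmf.expectation Q (($) (bit_monom S)) = p ^ card S"
\<comment> \<open>The factorisation rule for independent variables asks for a nonempty index set;
  the empty monomial is the constant 1.\<close>
proof (cases "S = {}")
  case True
  then show ?thesis
    using sum_pmf_eq_1[of UNIV Q] by (simp add: bit_monom_def expectation_finite_type)
next
  case False
  have ind: "prob_space.indep_vars Q (\<lambda>_. count_space UNIV) (\<lambda>i x. x i) S"
    and pr: "\<And>i. i \<in> S \<Longrightarrow> measure_pmf.prob Q {x. x i} = p"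
    using assms by (auto simp: kwise_indep_dists_def)
  have "measure_pmf.expectation Q (($) (bit_monom S)) = measure_pmf.prob Q (\<Inter>i\<in>S. (\<lambda>x. x i) -` {True})"
    using expectation_prod_bits[where J=S and A="\<lambda>_. {True}" and Q=Q]
    by (simp add: bit_monom_def vec_lambda_inverse)
  also have "\<dots> = (\<Prod>i\<in>S. measure_pmf.prob Q ((\<lambda>x. x i) -` {True}))"
    using prob_space.indep_varsD_finite[OF measure_pmf.prob_space_axioms ind False, of "\<lambda>_. {True}"] by simp
  also have "\<dots> = p ^ card S" using pr by (simp add: vimage_def)
  finally show ?thesis .
qed

text \<open>Forwards, both expectations of a monomial equal \<open>p ^ card S\<close>, and linearity
  extends this to the span. Backwards, product events on at most \<open>k\<close> bits have
  indicators in the span, so \<open>Q\<close> inherits marginals and factorisation from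
  \<open>iid_bits p\<close>.\<close>

lemma kwise_indep_dists_iff:
  fixes Q :: "('n::finite \<Rightarrow> bool) pmf"
  assumes p: "0 < p" "p < 1"
  shows "Q \<in> kwise_indep_dists k p \<longleftrightarrow>
    (\<forall>h\<in>low_degree k. measure_pmf.expectation Q (($) h) = measure_pmf.expectation (iid_bits p) (($) h))"
    (is "_ \<longleftrightarrow> (\<forall>h\<in>_. ?agree h)")
proof
  assume Q: "Q \<in> kwise_indep_dists k p"
  show "\<forall>h\<in>low_degree k. ?agree h"
  proof
    fix h :: "real^('n \<Rightarrow> bool)" assume "h \<in> low_degree k"
    then show "?agree h" unfolding low_degree_def
    proof (induction rule: span_induct_alt)
      case (step c y z)
      then obtain S where "card S \<le> k" "y = bit_monom S" by blast
      then have "?agree y"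
        using expectation_bit_monom_kwise[OF Q] expectation_bit_monom_kwise[OF iid_bits_kwise[OF p]] by metis
      with step show ?case
        by (simp add: expectation_finite_type distrib_right sum.distrib mult.assoc flip: sum_distrib_left)
    qed simp
  qed
next
  assume agree: "\<forall>h\<in>low_degree k. ?agree h"
  let ?I = "iid_bits p :: ('n \<Rightarrow> bool) pmf"
  have cyl: "measure_pmf.prob Q (\<Inter>j\<in>J. (\<lambda>x. x j) -` A j) =
             measure_pmf.prob ?I (\<Inter>j\<in>J. (\<lambda>x. x j) -` A j)"
    if "card J \<le> k" for J and A :: "'n \<Rightarrow> bool set"
    using bspec[OF agree prod_bits_in_low_degree[OF that, of A]]
    by (simp add: vec_lambda_inverse expectation_prod_bits)
  have I: "?I \<in> kwise_indep_dists k p" by (rule iid_bits_kwise[OF p])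
  show "Q \<in> kwise_indep_dists k p"
    unfolding kwise_indep_dists_def
  proof (intro CollectI allI impI conjI ballI)
    fix S :: "'n set" assume S: "card S \<le> k"
    have le: "card J \<le> k" if "J \<subseteq> S" for J using card_mono[OF _ that] S by simp
    \<comment> \<open>The case \<open>J = {j}\<close>. Its size is within \<open>k\<close> because
      \<open>j \<in> S\<close>; for \<open>k = 0\<close> the set \<open>S\<close> is empty.\<close>
    have cyl1: "measure_pmf.prob Q ((\<lambda>x. x j) -` B) = measure_pmf.prob ?I ((\<lambda>x. x j) -` B)"
      if "j \<in> S" for j and B
      using cyl[OF le[of "{j}"], of "\<lambda>_. B"] that by simp
    have ind: "prob_space.indep_vars ?I (\<lambda>_. count_space UNIV) (\<lambda>i x. x i) S"
      using I S by (auto simp: kwise_indep_dists_def)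
    show "prob_space.indep_vars Q (\<lambda>_. count_space UNIV) (\<lambda>i x. x i) S"
      unfolding prob_space.indep_vars_def2[OF measure_pmf.prob_space_axioms]
    proof (intro conjI ballI prob_space.indep_setsI[OF measure_pmf.prob_space_axioms])
      fix C :: "'n \<Rightarrow> ('n \<Rightarrow> bool) set" and J
      assume J: "J \<noteq> {}" "J \<subseteq> S" "finite J"
        and C: "\<forall>j\<in>J. C j \<in> {(\<lambda>x. x j) -` A \<inter> space Q |A. A \<in> sets (count_space UNIV)}"
      then obtain A where A: "\<And>j. j \<in> J \<Longrightarrow> C j = (\<lambda>x. x j) -` A j" by simp metis
      \<comment> \<open>Pass to the independent bits, factor there, and return one bit at a
        time.\<close>
      have "measure_pmf.prob Q (\<Inter>j\<in>J. C j) = measure_pmf.prob ?I (\<Inter>j\<in>J. (\<lambda>x. x j) -` A j)"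
        using cyl[OF le[OF J(2)], of A] A by simp
      also have "\<dots> = (\<Prod>j\<in>J. measure_pmf.prob ?I ((\<lambda>x. x j) -` A j))"
        using prob_space.indep_varsD[OF measure_pmf.prob_space_axioms ind J(1,3,2), of A] by simp
      also have "\<dots> = (\<Prod>j\<in>J. measure_pmf.prob Q (C j))"
        using J(2) by (intro prod.cong) (auto simp: A cyl1)
      finally show "measure_pmf.prob Q (\<Inter>j\<in>J. C j) = (\<Prod>j\<in>J. measure_pmf.prob Q (C j))" .
    qed auto
    show "measure_pmf.prob Q {x. x i} = p" if "i \<in> S" for i
      using cyl1[OF that, of "{True}"] I S that by (auto simp: kwise_indep_dists_def vimage_def)
  qed
qed

section \<open>Strong and weak duality for k-wise independent bits\<close>

text \<open>\<open>F\<close> is real-valued rather than an indicator so that the result also applies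
  to a negated indicator.\<close>

lemma kwise_duality:
  fixes F :: "real^('n::finite \<Rightarrow> bool)"
  assumes p: "0 < p" "p < 1"
  obtains Q P where "Q \<in> kwise_indep_dists k p" "rpoly_degree P \<le> k"
    "\<And>x. F $ x \<le> rpoly_eval P (bits_to_reals x)"
    "measure_pmf.expectation Q (($) F) = iid_expectation p P"
proof -
  \<comment> \<open>The strict bounds on \<open>p\<close> give every point of the cube positive
    mass, as the duality requires.\<close>
  have full: "set_pmf (iid_bits p :: ('n \<Rightarrow> bool) pmf) = UNIV"
    using p by (auto simp: iid_bits_def set_Pi_pmf PiE_dflt_def)
  have "subspace (low_degree k)" unfolding low_degree_def by simp
  \<comment> \<open>The empty monomial has degree 0, so constants are available for every
    \<open>k\<close>.\<close>
  moreover have "vec 1 = (bit_monom {} :: real^('n \<Rightarrow> bool))"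
    by (simp add: vec_eq_iff bit_monom_def)
  then have "vec 1 \<in> (low_degree k :: (real^('n \<Rightarrow> bool)) set)"
    unfolding low_degree_def by (auto intro!: span_base)
  ultimately obtain Q and g :: "real^('n \<Rightarrow> bool)" where "g \<in> low_degree k" and g: "\<And>x. F $ x \<le> g $ x"
    and Q: "\<And>h. h \<in> low_degree k \<Longrightarrow>
      measure_pmf.expectation Q (($) h) = measure_pmf.expectation (iid_bits p) (($) h)"
    and eq: "measure_pmf.expectation Q (($) F) = measure_pmf.expectation (iid_bits p) (($) g)"
    by (rule finite_lp_duality[OF full, of "low_degree k" F]) (rule that)
  obtain P where "rpoly_degree P \<le> k" "\<And>x. rpoly_eval P (bits_to_reals x) = g $ x"
    using rpoly_of_low_degree[OF \<open>g \<in> low_degree k\<close>] by blast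
  moreover have "Q \<in> kwise_indep_dists k p" using Q by (simp add: kwise_indep_dists_iff[OF p])
  ultimately show ?thesis using g eq by (intro that[of Q P]) (simp_all add: iid_expectation_def)
qed

lemma expectation_rpoly_kwise:
  assumes "0 < p" "p < 1" "Q \<in> kwise_indep_dists k p" "rpoly_degree P \<le> k"
  shows "measure_pmf.expectation Q (\<lambda>x. rpoly_eval P (bits_to_reals x)) = iid_expectation p P"
  using bspec[OF assms(3)[unfolded kwise_indep_dists_iff[OF assms(1,2)]] rpoly_in_low_degree[OF assms(4)]]
  by (simp add: iid_expectation_def vec_lambda_inverse)

lemma expectation_of_bool:
  "measure_pmf.expectation Q (\<lambda>x. of_bool (f x)) = measure_pmf.prob Q {x. f x}"
proof -
  have "(\<lambda>x. of_bool (f x)) = (indicator {x. f x} :: _ \<Rightarrow> real)" by (auto simp: fun_eq_iff)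
  then show ?thesis by simp
qed

text \<open>Weak duality: integrate the pointwise bound under \<open>Q\<close>, then replace
  \<open>Q\<close> by \<open>iid_bits p\<close>, which does not change the expectation of a
  polynomial of degree at most \<open>k\<close>.\<close>

lemma prob_le_upper_poly:
  assumes "0 < p" "p < 1" "Q \<in> kwise_indep_dists k p" "P \<in> upper_polys k f"
  shows "measure_pmf.prob Q {x. f x} \<le> iid_expectation p P"
proof -
  have "measure_pmf.prob Q {x. f x} \<le> measure_pmf.expectation Q (\<lambda>x. rpoly_eval P (bits_to_reals x))"
    using assms(4) unfolding expectation_of_bool[symmetric] upper_polys_def
    by (auto intro!: integral_mono integrable_measure_pmf_finite)
  then show ?thesis using assms by (simp add: expectation_rpoly_kwise upper_polys_def)
qed

lemma prob_ge_lower_poly: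
  assumes "0 < p" "p < 1" "Q \<in> kwise_indep_dists k p" "P \<in> lower_polys k f"
  shows "iid_expectation p P \<le> measure_pmf.prob Q {x. f x}"
proof -
  have "measure_pmf.expectation Q (\<lambda>x. rpoly_eval P (bits_to_reals x)) \<le> measure_pmf.prob Q {x. f x}"
    using assms(4) unfolding expectation_of_bool[symmetric] lower_polys_def
    by (auto intro!: integral_mono integrable_measure_pmf_finite)
  then show ?thesis using assms by (simp add: expectation_rpoly_kwise lower_polys_def)
qed

lemma rpoly_uminus:
  "rpoly_degree (- P) = rpoly_degree P" "rpoly_eval (- P) x = - rpoly_eval P x"
proof -
  have "Poly_Mapping.keys (- P) = Poly_Mapping.keys P" by (auto simp: in_keys_iff)
  then show "rpoly_degree (- P) = rpoly_degree P" "rpoly_eval (- P) x = - rpoly_eval P x"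
    by (simp_all add: rpoly_degree_def rpoly_eval_def sum_negf)
qed

theorem proposition4:
  fixes f :: "('n::finite \<Rightarrow> bool) \<Rightarrow> bool" and k :: nat and p :: real
  assumes "k \<le> CARD('n)" and "0 < p" and "p < 1"
  shows "(\<exists>Q P.
            is_arg_max (\<lambda>Q. measure_pmf.prob Q {x. f x}) (\<lambda>Q. Q \<in> kwise_indep_dists k p) Q \<and>
            is_arg_min (iid_expectation p) (\<lambda>P. P \<in> upper_polys k f) P \<and>
            measure_pmf.prob Q {x. f x} = iid_expectation p P) \<and>
         (\<exists>Q P.
            is_arg_min (\<lambda>Q. measure_pmf.prob Q {x. f x}) (\<lambda>Q. Q \<in> kwise_indep_dists k p) Q \<and>
            is_arg_max (iid_expectation p) (\<lambda>P. P \<in> lower_polys k f) P \<and>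
            measure_pmf.prob Q {x. f x} = iid_expectation p P)"
proof (intro conjI)
  note p = assms(2,3)
  define F :: "real^('n \<Rightarrow> bool)" where "F = (\<chi> x. of_bool (f x))"
  obtain Q P where Q: "Q \<in> kwise_indep_dists k p" and P: "rpoly_degree P \<le> k"
    "\<And>x. F $ x \<le> rpoly_eval P (bits_to_reals x)"
    and eq: "measure_pmf.expectation Q (($) F) = iid_expectation p P"
    using kwise_duality[OF p] by blast
  have "P \<in> upper_polys k f" using P by (simp add: upper_polys_def F_def)
  moreover have "measure_pmf.prob Q {x. f x} = iid_expectation p P"
    using eq by (simp add: F_def vec_lambda_inverse expectation_of_bool)
  \<comment> \<open>\<open>Q\<close> and \<open>P\<close> are feasible with equal values, so weak
    duality makes both optimal.\<close>
  ultimately show "\<exists>Q P.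
      is_arg_max (\<lambda>Q. measure_pmf.prob Q {x. f x}) (\<lambda>Q. Q \<in> kwise_indep_dists k p) Q \<and>
      is_arg_min (iid_expectation p) (\<lambda>P. P \<in> upper_polys k f) P \<and>
      measure_pmf.prob Q {x. f x} = iid_expectation p P"
    using Q prob_le_upper_poly[OF p] unfolding is_arg_max_linorder is_arg_min_linorder by metis
  \<comment> \<open>The new \<open>P\<close> lies above \<open>- F\<close>, so \<open>- P\<close> is
    a lower polynomial; negating the common value turns it into the probability of \<open>f\<close>
    under \<open>Q\<close>.\<close>
  obtain Q P where Q: "Q \<in> kwise_indep_dists k p" and P: "rpoly_degree P \<le> k"
    "\<And>x. (- F) $ x \<le> rpoly_eval P (bits_to_reals x)"
    and eq: "measure_pmf.expectation Q (($) (- F)) = iid_expectation p P"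
    using kwise_duality[OF p] by blast
  have "- P \<in> lower_polys k f"
    using P by (simp add: lower_polys_def F_def rpoly_uminus minus_le_iff)
  moreover have "measure_pmf.prob Q {x. f x} = iid_expectation p (- P)"
  proof -
    have "(($) (- F)) = (\<lambda>x. - of_bool (f x))" by (simp add: F_def fun_eq_iff)
    then show ?thesis using eq by (simp add: expectation_of_bool iid_expectation_def rpoly_uminus)
  qed
  ultimately show "\<exists>Q P.
      is_arg_min (\<lambda>Q. measure_pmf.prob Q {x. f x}) (\<lambda>Q. Q \<in> kwise_indep_dists k p) Q \<and>
      is_arg_max (iid_expectation p) (\<lambda>P. P \<in> lower_polys k f) P \<and>
      measure_pmf.prob Q {x. f x} = iid_expectation p P"
    using Q prob_ge_lower_poly[OF p] unfolding is_arg_max_linorder is_arg_min_linorder by metis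
qed

end
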